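(* Let $T,D,a\in\mathbb{R}$ with $a^2+D^2\neq0$ and let $P:I\to(-\infty,0]$ be the left Poincaré half-map of the system $\dot x=Tx-y$, $\dot y=Dx-a$ associated to $\Sigma=\{x=0\}$. Assume that $4D-T^2>0$. Then the Taylor expansion of $P$ around infinity (i.e. as $y_0\to+\infty$) is $$ \begin{aligned} P(y_0)={}&-\exp\left(\frac{\pi T}{\sqrt{4D-T^2}}\right)y_0+\frac{aT}{D}\left(1+\exp\left(\frac{\pi T}{\sqrt{4D-T^2}}\right)\right)-\frac{a^2}{D}\sinh\left(\frac{\pi T}{\sqrt{4D-T^2}}\right)\cdot\frac{1}{y_0}\\ &-\frac{a^3\,T\,e^{-\frac{2\pi T}{\sqrt{4D-T^2}}}\left(-2+e^{\frac{\pi T}{\sqrt{4D-T^2}}}\right)\left(1+e^{\frac{\pi T}{\sqrt{4D-T^2}}}\right)^2}{6D^2}\cdot\frac{1}{y_0^2}+\mathcal{O}\left(\frac{1}{y_0^3}\right). \end{aligned} $$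
   Context: Let $T,D,a\in\mathbb{R}$ with $a^2+D^2\neq0$ (standing assumption) and consider the planar linear system $\dot x=Tx-y$, $\dot y=Dx-a$, with Poincaré section $\Sigma=\{(x,y)\in\mathbb{R}^2:x=0\}$. Left Poincaré half-map $P$: for $y_0\geqslant0$ let $\Phi(t;y_0)=(\Phi_1(t;y_0),\Phi_2(t;y_0))$ be the solution with $\Phi(0;y_0)=(0,y_0)$. If there exists $\tau(y_0)>0$ such that $\Phi_1(\tau(y_0);y_0)=0$ and $\Phi_1(t;y_0)<0$ for every $t\in(0,\tau(y_0))$, put $P(y_0)=\Phi_2(\tau(y_0);y_0)\leqslant0$. If $P(0)$ is not defined by this rule, but for every $\varepsilon>0$ there exist $y_0\in(0,\varepsilon)$ and $y_1\in(-\varepsilon,0)$ with $P(y_0)=y_1$, then $P$ is extended continuously by $P(0)=0$. The domain of $P$ is the interval $I\subset[0,+\infty)$ of all $y_0$ where $P$ is so defined. When $4D-T^2>0$ the interval $I$ is unbounded and $P(y_0)\to-\infty$ as $y_0\to+\infty$. *)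

theory Defs
  imports "HOL-Analysis.Analysis" "HOL-Library.Landau_Symbols"
begin

definition is_solution :: "real \<Rightarrow> real \<Rightarrow> real \<Rightarrow> (real \<Rightarrow> real \<times> real) \<Rightarrow> bool" where
  "is_solution T D a \<phi> \<longleftrightarrow>
     (\<forall>t. (\<phi> has_vector_derivative
            (T * fst (\<phi> t) - snd (\<phi> t), D * fst (\<phi> t) - a)) (at t))"

(* An affine system has exactly one solution on the whole real line for each initial
   condition, so the description below is proper. *)
definition Phi :: "real \<Rightarrow> real \<Rightarrow> real \<Rightarrow> real \<Rightarrow> real \<Rightarrow> real \<times> real" where
  "Phi T D a y0 = (THE \<phi>. is_solution T D a \<phi> \<and> \<phi> 0 = (0, y0))"

definition is_flight_time :: "real \<Rightarrow> real \<Rightarrow> real \<Rightarrow> real \<Rightarrow> real \<Rightarrow> bool" where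
  "is_flight_time T D a y0 \<tau> \<longleftrightarrow>
     \<tau> > 0 \<and> fst (Phi T D a y0 \<tau>) = 0 \<and> (\<forall>t\<in>{0<..<\<tau>}. fst (Phi T D a y0 t) < 0)"

definition return_domain :: "real \<Rightarrow> real \<Rightarrow> real \<Rightarrow> real set" where
  "return_domain T D a = {y0. y0 \<ge> 0 \<and> (\<exists>\<tau>. is_flight_time T D a y0 \<tau>)}"

(* A flight time is unique if it exists: the first component is negative before it
   and zero at it. *)
definition return_map :: "real \<Rightarrow> real \<Rightarrow> real \<Rightarrow> real \<Rightarrow> real" where
  "return_map T D a y0 = snd (Phi T D a y0 (THE \<tau>. is_flight_time T D a y0 \<tau>))"

definition extends_to_zero :: "real \<Rightarrow> real \<Rightarrow> real \<Rightarrow> bool" where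
  "extends_to_zero T D a \<longleftrightarrow>
     0 \<notin> return_domain T D a \<and>
     (\<forall>\<epsilon>>0. \<exists>y0\<in>{0<..<\<epsilon>}. \<exists>y1\<in>{-\<epsilon><..<0}.
        y0 \<in> return_domain T D a \<and> return_map T D a y0 = y1)"

definition left_domain :: "real \<Rightarrow> real \<Rightarrow> real \<Rightarrow> real set" where
  "left_domain T D a =
     return_domain T D a \<union> (if extends_to_zero T D a then {0} else {})"

(* A partial map: values outside left_domain are unspecified. *)
definition left_half_map :: "real \<Rightarrow> real \<Rightarrow> real \<Rightarrow> real \<Rightarrow> real" where
  "left_half_map T D a y0 =
     (if y0 \<in> return_domain T D a then return_map T D a y0
      else if y0 = 0 \<and> extends_to_zero T D a then 0
      else undefined)"

end

theory Submission
  imports Defs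
begin

text \<open>
  The eigenvalues of the linear part are \<open>w (k \<plusminus> \<i>)\<close> with \<open>w > 0\<close>, and with \<open>m\<close> equal to \<open>w\<close>
  times the abscissa of the equilibrium, the orbit of \<open>(0, y0)\<close> meets the section at the phases
  \<open>\<phi> = w t\<close> with \<open>m (exp (- k \<phi>) - cos \<phi> + k sin \<phi>) = y0 sin \<phi>\<close>. For large \<open>y0\<close> the first
  positive one is \<open>\<phi> = pi + \<theta>\<close> with \<open>\<theta> = O(1 / y0)\<close>. Both \<open>u = m / y0\<close> and \<open>P(y0) / y0\<close> are then
  explicit analytic functions of \<open>\<theta>\<close>, so \<open>P(y0) / y0\<close> is compared with a cubic polynomial in \<open>u\<close>
  by expanding in \<open>\<theta>\<close> up to \<open>\<theta>\<^sup>4\<close>; no inversion of \<open>\<theta> \<mapsto> u\<close> is needed.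
\<close>

section \<open>Auxiliary estimates from real analysis\<close>

text \<open>Split off the factor \<open>x ^ n\<close> from the series: the cofactor is again a
  convergent power series, hence continuous and so bounded near 0.\<close>

lemma has_fps_expansion_imp_bigo:
  fixes F :: "'a :: {banach, real_normed_field} fps"
  assumes "f has_fps_expansion F" and "\<And>i. i < n \<Longrightarrow> fps_nth F i = 0"
  shows "f \<in> O[nhds 0](\<lambda>x. x ^ n)"
proof -
  define G where "G = fps_shift n F"
  have F: "F = G * fps_X ^ n"
    unfolding G_def using assms(2)
    by (intro fps_ext) (auto simp: fps_X_power_mult_right_nth)
  have "fps_conv_radius G > 0"
    using assms(1) by (simp add: G_def has_fps_expansion_def)
  hence G: "eval_fps G has_fps_expansion G"
    by (rule eval_fps_has_fps_expansion)
  have "(\<lambda>x. eval_fps G x * x ^ n) has_fps_expansion F"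
    unfolding F by (intro has_fps_expansion_mult has_fps_expansion_fps_X_power G)
  hence ev: "eventually (\<lambda>x. f x = eval_fps G x * x ^ n) (nhds 0)"
    using assms(1) unfolding has_fps_expansion_def by (auto elim: eventually_elim2)
  have "(eval_fps G \<longlongrightarrow> eval_fps G 0) (nhds 0)"
    using has_fps_expansion_imp_continuous[OF G, of UNIV] by (simp add: continuous_at tendsto_nhds_iff)
  hence "eval_fps G \<in> O[nhds 0](\<lambda>_. 1)"
    by (intro bigoI_tendsto[of _ _ "eval_fps G 0"]) auto
  hence "(\<lambda>x. eval_fps G x * x ^ n) \<in> O[nhds 0](\<lambda>x. 1 * x ^ n)"
    by (intro landau_o.big.mult) auto
  with ev show ?thesis
    by (subst landau_o.big.in_cong[OF ev]) simp
qed

text \<open>For positive \<open>x\<close>, the mean value theorem gives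
  \<open>x / 2 * cos (x / 2) \<le> sin (x / 2)\<close>. Multiplying by \<open>cos (x / 2)\<close>
  and using the double-angle formulas yields \<open>x * (1 + cos x) \<le> 2 * sin x\<close>, where
  \<open>cos x\<close> is nonnegative. Oddness covers negative \<open>x\<close>.\<close>

lemma abs_le_2_abs_sin:
  fixes x :: real
  assumes "\<bar>x\<bar> \<le> pi / 2"
  shows "\<bar>x\<bar> \<le> 2 * \<bar>sin x\<bar>"
proof -
  have pos: "x \<le> 2 * sin x" if x: "0 < x" "x \<le> pi / 2" for x :: real
  proof -
    obtain z where z: "0 < z" "z < x / 2" "sin (x / 2) - sin 0 = (x / 2 - 0) * cos z"
      using MVT2[of 0 "x / 2" sin cos] x by (auto intro!: derivative_eq_intros)
    have c: "0 \<le> cos (x / 2)"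
      using x by (intro cos_ge_zero) auto
    have "cos (x / 2) \<le> cos z"
      using z x pi_gt_zero by (intro cos_monotone_0_pi_le) linarith+
    hence "x / 2 * cos (x / 2) \<le> sin (x / 2)"
      using z x by simp
    hence "x / 2 * cos (x / 2) * cos (x / 2) \<le> sin (x / 2) * cos (x / 2)"
      using c by (rule mult_right_mono)
    moreover have "sin x = 2 * (sin (x / 2) * cos (x / 2))"
      using sin_double[of "x / 2"] by simp
    moreover have "cos (x / 2) * cos (x / 2) = (1 + cos x) / 2"
      using cos_double_cos[of "x / 2"] by (simp add: power2_eq_square)
    ultimately have "x * (1 + cos x) \<le> 2 * sin x"
      by (simp add: mult.assoc)
    moreover have "0 \<le> cos x"
      using x by (intro cos_ge_zero) auto
    hence "x * 1 \<le> x * (1 + cos x)"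
      using x by (intro mult_left_mono) auto
    ultimately show ?thesis
      by simp
  qed
  show ?thesis
    using pos[of x] pos[of "- x"] assms by (cases "x = 0") (auto simp: abs_if split: if_splits)
qed

text \<open>The zero set in \<open>{a..b}\<close> is compact and nonempty, so it has a least
  element; a nonnegative value before it would create an earlier zero. This supplies the strict
  negativity that a flight time demands before the return.\<close>

lemma first_zero:
  fixes f :: "real \<Rightarrow> real"
  assumes "a \<le> b" "continuous_on {a..b} f" "f a < 0" "0 < f b"
  obtains c where "a < c" "c < b" "f c = 0" "\<And>x. \<lbrakk>a \<le> x; x < c\<rbrakk> \<Longrightarrow> f x < 0"
proof -
  let ?Z = "{a..b} \<inter> f -` {0}"
  have ivt: "\<exists>z. a \<le> z \<and> z \<le> x \<and> f z = 0" if "a \<le> x" "x \<le> b" "0 \<le> f x" for x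
    using IVT'[of f a 0 x] that assms continuous_on_subset[OF assms(2), of "{a..x}"] by auto
  have "closed ?Z"
    using assms(2) by (intro continuous_on_closed_vimage[THEN iffD1, rule_format] continuous_closed_preimage) auto
  hence "compact ?Z"
    by (metis compact_Icc compact_Int_closed inf.right_idem inf_commute)
  moreover have "?Z \<noteq> {}"
    using ivt[of b] assms by auto
  ultimately obtain c where c: "c \<in> ?Z" "\<And>x. x \<in> ?Z \<Longrightarrow> c \<le> x"
    using compact_attains_inf[of ?Z] by blast
  show ?thesis
  proof
    show "a < c" "c < b" "f c = 0"
      using c(1) assms by (auto simp: order_le_less)
    show "f x < 0" if x: "a \<le> x" "x < c" for x
    proof (rule ccontr)
      assume "\<not> f x < 0"
      then obtain z where "a \<le> z" "z \<le> x" "f z = 0"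
        using ivt[of x] x c(1) by auto
      thus False
        using c(2)[of z] x c(1) by auto
    qed
  qed
qed

section \<open>Uniqueness of solutions and the explicit flow\<close>

lemma is_solution_unique:
  assumes sol: "is_solution T D a \<phi>" "is_solution T D a \<psi>"
    and init: "\<phi> 0 = \<psi> 0"
    and "T\<^sup>2 < 4 * D"
  shows "\<phi> = \<psi>"
proof
  fix t
  \<comment> \<open>For the difference of the two solutions, the definite form \<open>Q\<close> satisfies \<open>Q' = T Q\<close>.\<close>
  define x where "x = (\<lambda>t. fst (\<phi> t) - fst (\<psi> t))"
  define y where "y = (\<lambda>t. snd (\<phi> t) - snd (\<psi> t))"
  define Q where "Q = (\<lambda>t. D * (x t)\<^sup>2 - T * x t * y t + (y t)\<^sup>2)"
  have comp: "((\<lambda>t. fst (\<eta> t)) has_real_derivative T * fst (\<eta> t) - snd (\<eta> t)) (at t)"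
    "((\<lambda>t. snd (\<eta> t)) has_real_derivative D * fst (\<eta> t) - a) (at t)"
    if "is_solution T D a \<eta>" for \<eta> t
    using bounded_linear.has_vector_derivative[OF bounded_linear_fst, of \<eta> _ "at t"]
      bounded_linear.has_vector_derivative[OF bounded_linear_snd, of \<eta> _ "at t"] that
    unfolding is_solution_def has_real_derivative_iff_has_vector_derivative by fastforce+
  have x: "(x has_real_derivative T * x t - y t) (at t)" for t
    unfolding x_def y_def
    by (rule DERIV_cong[OF DERIV_diff[OF comp(1)[OF sol(1)] comp(1)[OF sol(2)]]])
      (simp add: algebra_simps)
  have y: "(y has_real_derivative D * x t) (at t)" for t
    unfolding x_def y_def
    by (rule DERIV_cong[OF DERIV_diff[OF comp(2)[OF sol(1)] comp(2)[OF sol(2)]]])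
      (simp add: algebra_simps)
  have "((\<lambda>t. exp (- T * t) * Q t) has_real_derivative 0) (at t)" for t
    unfolding Q_def
    by (auto intro!: derivative_eq_intros x y simp: algebra_simps power2_eq_square)
  hence "exp (- T * t) * Q t = exp (- T * 0) * Q 0"
    by (intro DERIV_isconst_all) auto
  moreover have "x 0 = 0" "y 0 = 0"
    using init by (auto simp: x_def y_def)
  ultimately have "Q t = 0"
    by (simp add: Q_def)
  \<comment> \<open>Completing the square: as \<open>T\<^sup>2 < 4 * D\<close>, both summands on the
    right are nonnegative, so \<open>Q t = 0\<close> makes each of them vanish.\<close>
  moreover have "4 * Q t = (4 * D - T\<^sup>2) * (x t)\<^sup>2 + (T * x t - 2 * y t)\<^sup>2"
    by (simp add: Q_def power2_eq_square algebra_simps)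
  ultimately have sum0: "(4 * D - T\<^sup>2) * (x t)\<^sup>2 + (T * x t - 2 * y t)\<^sup>2 = 0"
    by simp
  hence "(4 * D - T\<^sup>2) * (x t)\<^sup>2 = 0 \<and> (T * x t - 2 * y t)\<^sup>2 = 0"
    using assms(4) by (subst (asm) add_nonneg_eq_0_iff) auto
  hence "x t = 0 \<and> y t = 0"
    using assms(4) by auto
  thus "\<phi> t = \<psi> t"
    by (simp add: x_def y_def prod_eq_iff)
qed

text \<open>Andronov's function \<open>1 - exp (k * \<phi>) * (cos \<phi> - k * sin \<phi>)\<close>,
  divided by \<open>exp (k * \<phi>)\<close>. Up to scaling and the growth factor it is the first
  component of the orbit of the origin.\<close>

definition mode :: "real \<Rightarrow> real \<Rightarrow> real" where
  "mode k \<phi> = exp (- k * \<phi>) - cos \<phi> + k * sin \<phi>"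

definition mode' :: "real \<Rightarrow> real \<Rightarrow> real" where
  "mode' k \<phi> = - k * exp (- k * \<phi>) + sin \<phi> + k * cos \<phi>"

lemma mode_0 [simp]: "mode k 0 = 0" "mode' k 0 = 0"
  by (simp_all add: mode_def mode'_def)

lemma has_real_derivative_mode: "(mode k has_real_derivative mode' k \<phi>) (at \<phi> within A)"
  unfolding mode_def mode'_def by (auto intro!: derivative_eq_intros)

text \<open>An oscillator equation with exponential forcing. Writing the second derivative through
  \<open>mode\<close> itself lets the flow be differentiated with \<open>mode\<close> and
  \<open>mode'\<close> kept opaque.\<close>

lemma has_real_derivative_mode':
  "(mode' k has_real_derivative (1 + k\<^sup>2) * exp (- k * \<phi>) - mode k \<phi>) (at \<phi> within A)"
  unfolding mode_def mode'_def
  by (auto intro!: derivative_eq_intros simp: algebra_simps power2_eq_square)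

text \<open>\<open>mode k\<close> vanishes at 0 and has a bounded derivative on the compact
  interval. A bound linear in \<open>\<phi>\<close> is needed because \<open>mode k \<phi>\<close>
  is later compared with \<open>sin \<phi>\<close>, which also vanishes at 0.\<close>

lemma mode_bound:
  obtains C where "C > 0" "\<And>\<phi>. \<lbrakk>0 \<le> \<phi>; \<phi> \<le> 3 * pi / 2\<rbrakk> \<Longrightarrow> \<bar>mode k \<phi>\<bar> \<le> C * \<phi>"
proof -
  let ?I = "{0..3 * pi / 2}"
  have "bounded (mode' k ` ?I)"
    unfolding mode'_def by (intro compact_imp_bounded compact_continuous_image continuous_intros) auto
  then obtain C where C: "C > 0" "\<And>\<phi>. \<phi> \<in> ?I \<Longrightarrow> \<bar>mode' k \<phi>\<bar> \<le> C"
    unfolding bounded_pos by auto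
  show ?thesis
  proof
    show "\<bar>mode k \<phi>\<bar> \<le> C * \<phi>" if "0 \<le> \<phi>" "\<phi> \<le> 3 * pi / 2" for \<phi>
      using field_differentiable_bound[of ?I "mode k" "mode' k" C \<phi> 0] that C(2)
      by (auto intro: has_real_derivative_mode)
  qed fact
qed

text \<open>The second component is \<open>T * x - x'\<close> for the first component
  \<open>x\<close>, as the first equation of the system dictates, with
  \<open>T = 2 * k * w\<close>.\<close>

definition flow :: "real \<Rightarrow> real \<Rightarrow> real \<Rightarrow> real \<Rightarrow> real \<Rightarrow> real \<times> real" where
  "flow k w m y0 t =
     (exp (k * w * t) * (m * mode k (w * t) - y0 * sin (w * t)) / w,
      exp (k * w * t) * (k * (m * mode k (w * t) - y0 * sin (w * t))
                           - (m * mode' k (w * t) - y0 * cos (w * t))))"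

lemma is_solution_flow:
  assumes "w \<noteq> 0"
  shows "is_solution (2 * k * w) (w\<^sup>2 * (1 + k\<^sup>2)) (m * w * (1 + k\<^sup>2)) (flow k w m y0)"
proof -
  have [derivative_intros]:
    "((\<lambda>t. mode k (w * t)) has_real_derivative mode' k (w * t) * w) (at t)"
    "((\<lambda>t. mode' k (w * t)) has_real_derivative
       ((1 + k\<^sup>2) * exp (- k * (w * t)) - mode k (w * t)) * w) (at t)" for t
    by (auto intro!: DERIV_chain2[OF has_real_derivative_mode]
        DERIV_chain2[OF has_real_derivative_mode', simplified] derivative_eq_intros)
  \<comment> \<open>The second derivative of \<open>mode\<close> contributes the forcing
    \<open>(1 + k\<^sup>2) * exp (- k * (w * t))\<close>; the prefactor of the flow cancels its
    exponential and leaves the constant term of the system.\<close>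
  have e: "exp (k * w * t) * exp (- k * (w * t)) = 1" for t
    by (simp flip: exp_add add: algebra_simps)
  have "((\<lambda>t. fst (flow k w m y0 t)) has_real_derivative
      2 * k * w * fst (flow k w m y0 t) - snd (flow k w m y0 t)) (at t)" for t
    unfolding flow_def fst_conv snd_conv
    by (rule DERIV_cong, (rule derivative_intros assms)+) (use assms in \<open>simp add: field_simps\<close>)
  moreover have "((\<lambda>t. snd (flow k w m y0 t)) has_real_derivative
      w\<^sup>2 * (1 + k\<^sup>2) * fst (flow k w m y0 t) - m * w * (1 + k\<^sup>2)) (at t)" for t
  proof -
    have "((\<lambda>t. snd (flow k w m y0 t)) has_real_derivative
      w\<^sup>2 * (1 + k\<^sup>2) * fst (flow k w m y0 t)
        - m * w * (1 + k\<^sup>2) * (exp (k * w * t) * exp (- k * (w * t)))) (at t)"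
      unfolding flow_def fst_conv snd_conv
      by (rule DERIV_cong, (rule derivative_intros assms)+)
        (use assms in \<open>simp add: field_simps power2_eq_square\<close>)
    thus ?thesis unfolding e by simp
  qed
  ultimately have "((\<lambda>t. (fst (flow k w m y0 t), snd (flow k w m y0 t))) has_vector_derivative
      (2 * k * w * fst (flow k w m y0 t) - snd (flow k w m y0 t),
       w\<^sup>2 * (1 + k\<^sup>2) * fst (flow k w m y0 t) - m * w * (1 + k\<^sup>2))) (at t)" for t
    by (intro has_vector_derivative_Pair)
      (auto simp: has_real_derivative_iff_has_vector_derivative)
  thus ?thesis
    unfolding is_solution_def by simp
qed

lemma Phi_eq_flow:
  assumes "w \<noteq> 0"
  shows "Phi (2 * k * w) (w\<^sup>2 * (1 + k\<^sup>2)) (m * w * (1 + k\<^sup>2)) y0 = flow k w m y0"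
  unfolding Phi_def
proof (rule the_equality)
  show flow: "is_solution (2 * k * w) (w\<^sup>2 * (1 + k\<^sup>2)) (m * w * (1 + k\<^sup>2)) (flow k w m y0) \<and>
      flow k w m y0 0 = (0, y0)"
    using is_solution_flow[OF assms] by (simp add: flow_def)
  show "\<phi> = flow k w m y0"
    if "is_solution (2 * k * w) (w\<^sup>2 * (1 + k\<^sup>2)) (m * w * (1 + k\<^sup>2)) \<phi> \<and> \<phi> 0 = (0, y0)" for \<phi>
    \<comment> \<open>For these parameters \<open>4 * D - T\<^sup>2\<close> equals
      \<open>4 * w\<^sup>2\<close>, which is positive.\<close>
    using that flow assms
    by (intro is_solution_unique[of "2 * k * w" "w\<^sup>2 * (1 + k\<^sup>2)" "m * w * (1 + k\<^sup>2)"])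
      (auto simp: algebra_simps power2_eq_square zero_less_mult_iff)
qed

section \<open>Flight times and values of the return map\<close>

lemma return_map_eq:
  assumes "is_flight_time T D a y0 \<tau>" "0 \<le> y0"
  shows "y0 \<in> return_domain T D a" "return_map T D a y0 = snd (Phi T D a y0 \<tau>)"
proof -
  have "\<sigma> = \<tau>" if "is_flight_time T D a y0 \<sigma>" for \<sigma>
    using that assms(1) unfolding is_flight_time_def
    by (metis greaterThanLessThan_iff less_irrefl linorder_less_linear)
  hence "(THE \<tau>. is_flight_time T D a y0 \<tau>) = \<tau>"
    using assms(1) by (intro the_equality)
  thus "return_map T D a y0 = snd (Phi T D a y0 \<tau>)"
    by (simp add: return_map_def)
  show "y0 \<in> return_domain T D a"
    using assms by (auto simp: return_domain_def)
qed

text \<open>Passing to the phase \<open>w * t\<close> and dropping the positive factor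
  \<open>exp (k * w * t) / w\<close> turns the conditions on the orbit into a scalar comparison of
  \<open>m * mode k\<close> with \<open>y0 * sin\<close>.\<close>

lemma is_flight_timeI:
  assumes "w > 0" "\<phi> > 0"
    and "m * mode k \<phi> = y0 * sin \<phi>"
    and "\<And>s. \<lbrakk>0 < s; s < \<phi>\<rbrakk> \<Longrightarrow> m * mode k s < y0 * sin s"
  shows "is_flight_time (2 * k * w) (w\<^sup>2 * (1 + k\<^sup>2)) (m * w * (1 + k\<^sup>2)) y0 (\<phi> / w)"
  unfolding is_flight_time_def Phi_eq_flow[OF less_imp_neq[OF assms(1), symmetric]]
  using assms
  by (auto simp: flow_def pos_less_divide_eq mult_less_0_iff divide_less_0_iff mult.commute[of w])

section \<open>Local expansion in the phase near \<open>pi\<close>\<close>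

text \<open>With \<open>E = exp (k pi)\<close>, \<open>\<gamma> \<theta>\<close> and \<open>\<gamma>' \<theta>\<close> are \<open>mode k\<close> and \<open>mode' k\<close> at \<open>pi + \<theta>\<close>.\<close>

lemma transition_expansion:
  fixes k E :: real
  defines "\<gamma> \<equiv> \<lambda>\<theta>. exp (- k * \<theta>) / E + cos \<theta> - k * sin \<theta>"
  defines "\<gamma>' \<equiv> \<lambda>\<theta>. - k * exp (- k * \<theta>) / E - sin \<theta> - k * cos \<theta>"
  assumes "E > 0"
  shows "\<exists>\<delta>>0. \<exists>K>0. \<forall>\<theta> u. \<bar>\<theta>\<bar> < \<delta> \<longrightarrow> u * \<gamma> \<theta> = - sin \<theta> \<longrightarrow>
       \<bar>- E * exp (k * \<theta>) * (u * \<gamma>' \<theta> + cos \<theta>)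
         - (- E + 2 * k * (1 + E) * u - (1 + k\<^sup>2) * (E - 1 / E) / 2 * u\<^sup>2
            + k * (1 + k\<^sup>2) * (1 + E)\<^sup>2 * (2 - E) / (3 * E\<^sup>2) * u ^ 3)\<bar> \<le> K * \<theta> ^ 4"
proof -
  define G where "G = fps_const (1 / E) * fps_exp (- k) + fps_cos 1 - fps_const k * fps_sin 1"
  define G' where "G' = fps_const (- k / E) * fps_exp (- k) - fps_sin 1 - fps_const k * fps_cos 1"
  define H where "H = fps_const (- E) * fps_exp k * (- fps_sin 1 * G\<^sup>2 * G' + G ^ 3 * fps_cos 1)
    + fps_const E * G ^ 3 + fps_const (2 * k * (1 + E)) * fps_sin 1 * G\<^sup>2
    + fps_const ((1 + k\<^sup>2) * (E - 1 / E) / 2) * (fps_sin 1)\<^sup>2 * G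
    + fps_const (k * (1 + k\<^sup>2) * (1 + E)\<^sup>2 * (2 - E) / (3 * E\<^sup>2)) * (fps_sin 1) ^ 3"
  \<comment> \<open>\<open>h\<close> is the difference to be estimated, multiplied by \<open>\<gamma>\<^sup>3\<close>.\<close>
  define h where "h = (\<lambda>\<theta>. - E * exp (k * \<theta>) * (- sin \<theta> * (\<gamma> \<theta>)\<^sup>2 * \<gamma>' \<theta> + \<gamma> \<theta> ^ 3 * cos \<theta>)
    + E * \<gamma> \<theta> ^ 3 + 2 * k * (1 + E) * sin \<theta> * (\<gamma> \<theta>)\<^sup>2
    + (1 + k\<^sup>2) * (E - 1 / E) / 2 * (sin \<theta>)\<^sup>2 * \<gamma> \<theta>
    + k * (1 + k\<^sup>2) * (1 + E)\<^sup>2 * (2 - E) / (3 * E\<^sup>2) * (sin \<theta>) ^ 3)"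
  have "(\<lambda>\<theta>. 1 / E * exp (- k * \<theta>) + cos \<theta> - k * sin \<theta>) has_fps_expansion G"
    unfolding G_def by (intro fps_expansion_intros)
  hence G: "\<gamma> has_fps_expansion G"
    by (simp add: \<gamma>_def)
  have "(\<lambda>\<theta>. - k / E * exp (- k * \<theta>) - sin \<theta> - k * cos \<theta>) has_fps_expansion G'"
    unfolding G'_def by (intro fps_expansion_intros)
  hence G': "\<gamma>' has_fps_expansion G'"
    by (simp add: \<gamma>'_def)
  have "h has_fps_expansion H"
    unfolding h_def H_def power2_eq_square power3_eq_cube
    by (intro fps_expansion_intros G G')
  \<comment> \<open>This verifies the coefficients of the cubic:
    \<open>u = - sin \<theta> / \<gamma> \<theta>\<close> has order 1 in \<open>\<theta>\<close>, so
    the remainder must vanish at orders 0 to 3.\<close>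
  moreover have "fps_nth H i = 0" if "i < 4" for i
  proof -
    have s: "fps_nth (fps_sin (1 :: real)) (Suc (Suc 0)) = 0"
        "fps_nth (fps_sin (1 :: real)) (Suc (Suc (Suc 0))) = - 1 / 6"
      and c: "fps_nth (fps_cos (1 :: real)) (Suc (Suc 0)) = - 1 / 2"
        "fps_nth (fps_cos (1 :: real)) (Suc (Suc (Suc 0))) = 0"
      using fps_sin_nth_add_2[of "1 :: real" 0] fps_sin_nth_add_2[of "1 :: real" 1]
        fps_cos_nth_add_2[of "1 :: real" 0] fps_cos_nth_add_2[of "1 :: real" 1]
      by (simp_all add: eval_nat_numeral)
    have g: "fps_nth G 0 = 1 / E + 1" "fps_nth G (Suc 0) = - k / E - k"
        "fps_nth G (Suc (Suc 0)) = k\<^sup>2 / 2 / E - 1 / 2"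
        "fps_nth G (Suc (Suc (Suc 0))) = - (k ^ 3) / (6 * E) + k / 6"
      and g': "fps_nth G' 0 = - k / E - k" "fps_nth G' (Suc 0) = k\<^sup>2 / E - 1"
        "fps_nth G' (Suc (Suc 0)) = - (k ^ 3) / E / 2 + k / 2"
        "fps_nth G' (Suc (Suc (Suc 0))) = k ^ 4 / (6 * E) + 1 / 6"
      by (simp_all add: G_def G'_def s c fact_numeral eval_nat_numeral field_simps)
    show ?thesis
      using that \<open>E > 0\<close> unfolding H_def
      by (auto simp add: less_Suc_eq numeral_eq_Suc fps_mult_nth g g' s c) (simp_all add: field_simps)
  qed
  ultimately have "h \<in> O[nhds 0](\<lambda>\<theta>. \<theta> ^ 4)"
    by (rule has_fps_expansion_imp_bigo)
  then obtain K where K: "K > 0" "\<forall>\<^sub>F \<theta> in nhds 0. norm (h \<theta>) \<le> K * norm (\<theta> ^ 4)"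
    by (elim landau_o.bigE)
  \<comment> \<open>Since \<open>\<gamma> 0 = 1 + 1 / E > 1\<close>, undoing the multiplication by
    \<open>\<gamma>\<^sup>3\<close> near 0 cannot enlarge the error.\<close>
  have "isCont \<gamma> 0"
    unfolding \<gamma>_def by (intro continuous_intros) (use \<open>E > 0\<close> in auto)
  hence "(\<gamma> \<longlongrightarrow> \<gamma> 0) (nhds 0)"
    by (simp add: continuous_at tendsto_nhds_iff)
  hence "\<forall>\<^sub>F \<theta> in nhds 0. \<gamma> \<theta> > 1"
    by (rule order_tendstoD) (use \<open>E > 0\<close> in \<open>simp add: \<gamma>_def\<close>)
  with K(2) have "\<forall>\<^sub>F \<theta> in nhds 0. norm (h \<theta>) \<le> K * norm (\<theta> ^ 4) \<and> \<gamma> \<theta> > 1"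
    by (rule eventually_conj)
  then obtain \<delta> where \<delta>: "\<delta> > 0" "\<And>\<theta>. \<bar>\<theta>\<bar> < \<delta> \<Longrightarrow> \<bar>h \<theta>\<bar> \<le> K * \<theta> ^ 4 \<and> \<gamma> \<theta> > 1"
    unfolding eventually_nhds_metric by (auto simp: dist_real_def)
  show ?thesis
  proof (intro exI conjI allI impI)
    fix \<theta> u
    assume \<theta>: "\<bar>\<theta>\<bar> < \<delta>" and u: "u * \<gamma> \<theta> = - sin \<theta>"
    let ?R = "- E * exp (k * \<theta>) * (u * \<gamma>' \<theta> + cos \<theta>)
         - (- E + 2 * k * (1 + E) * u - (1 + k\<^sup>2) * (E - 1 / E) / 2 * u\<^sup>2
            + k * (1 + k\<^sup>2) * (1 + E)\<^sup>2 * (2 - E) / (3 * E\<^sup>2) * u ^ 3)"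
    have s: "sin \<theta> = - (u * \<gamma> \<theta>)"
      using u by simp
    \<comment> \<open>A purely polynomial identity. The sine is written as \<open>- (u * g)\<close>
      so that the right side matches \<open>h\<close> once \<open>s\<close> has been
      rewritten.\<close>
    have poly: "(X * (u * g' + c) - (- E + p * u - q * u\<^sup>2 + r * u ^ 3)) * g ^ 3 =
        X * (- (- (u * g)) * g\<^sup>2 * g' + g ^ 3 * c) + E * g ^ 3 + p * (- (u * g)) * g\<^sup>2
          + q * (- (u * g))\<^sup>2 * g + r * (- (u * g)) ^ 3" for X c p q r g g' :: real
      by (simp add: power2_eq_square power3_eq_cube algebra_simps)
    have R: "?R * \<gamma> \<theta> ^ 3 = h \<theta>"
      unfolding h_def s by (rule poly)
    have g1: "1 \<le> \<gamma> \<theta> ^ 3"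
      using \<delta>(2)[OF \<theta>] by (intro one_le_power) simp
    have "\<bar>?R\<bar> * 1 \<le> \<bar>?R\<bar> * \<gamma> \<theta> ^ 3"
      using g1 by (rule mult_left_mono) (rule abs_ge_zero)
    also have "\<dots> = \<bar>?R * \<gamma> \<theta> ^ 3\<bar>"
      unfolding abs_mult using order_trans[OF zero_le_one g1] by (simp only: abs_of_nonneg)
    also have "\<dots> = \<bar>h \<theta>\<bar>"
      by (simp only: R)
    also have "\<dots> \<le> K * \<theta> ^ 4"
      using \<delta>(2)[OF \<theta>] by blast
    finally show "\<bar>?R\<bar> \<le> K * \<theta> ^ 4"
      by (simp only: mult_1_right)
  qed fact+
qed

section \<open>Expansion of the return map for large \<open>y0\<close>\<close>

text \<open>The return value is \<open>y0\<close> times the function expanded above, at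
  \<open>u = m / y0\<close>. As \<open>\<theta>\<close> is of order \<open>1 / y0\<close>, the error
  \<open>y0 * \<theta> ^ 4\<close> is of order \<open>1 / y0 ^ 3\<close>.\<close>

lemma return_map_expansion:
  fixes k w m :: real
  defines "E \<equiv> exp (k * pi)"
  assumes "w > 0"
  shows "\<exists>Y>0. \<exists>K. \<forall>y0>Y. y0 \<in> return_domain (2 * k * w) (w\<^sup>2 * (1 + k\<^sup>2)) (m * w * (1 + k\<^sup>2)) \<and>
       \<bar>return_map (2 * k * w) (w\<^sup>2 * (1 + k\<^sup>2)) (m * w * (1 + k\<^sup>2)) y0
         - (- E * y0 + 2 * k * (1 + E) * m - (1 + k\<^sup>2) * (E - 1 / E) / 2 * m\<^sup>2 / y0
            + k * (1 + k\<^sup>2) * (1 + E)\<^sup>2 * (2 - E) / (3 * E\<^sup>2) * m ^ 3 / y0\<^sup>2)\<bar> \<le> K / y0 ^ 3"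
proof -
  let ?T = "2 * k * w" and ?D = "w\<^sup>2 * (1 + k\<^sup>2)" and ?a = "m * w * (1 + k\<^sup>2)"
  have "E > 0"
    by (simp add: E_def)
  obtain C where C: "C > 0" "\<And>\<phi>. \<lbrakk>0 \<le> \<phi>; \<phi> \<le> 3 * pi / 2\<rbrakk> \<Longrightarrow> \<bar>mode k \<phi>\<bar> \<le> C * \<phi>"
    using mode_bound[of k] by blast
  obtain \<delta> K where "\<delta> > 0" "K > 0" and expansion:
    "\<forall>\<theta> u. \<bar>\<theta>\<bar> < \<delta> \<longrightarrow> u * (exp (- k * \<theta>) / E + cos \<theta> - k * sin \<theta>) = - sin \<theta> \<longrightarrow>
       \<bar>- E * exp (k * \<theta>) * (u * (- k * exp (- k * \<theta>) / E - sin \<theta> - k * cos \<theta>) + cos \<theta>)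
         - (- E + 2 * k * (1 + E) * u - (1 + k\<^sup>2) * (E - 1 / E) / 2 * u\<^sup>2
            + k * (1 + k\<^sup>2) * (1 + E)\<^sup>2 * (2 - E) / (3 * E\<^sup>2) * u ^ 3)\<bar> \<le> K * \<theta> ^ 4"
    using transition_expansion[OF \<open>E > 0\<close>, of k] by (elim exE conjE)
  \<comment> \<open>The factor 6 exceeds \<open>3 * pi / 2\<close>, so \<open>M\<close> bounds
    \<open>m * mode k\<close> on the whole phase window; it also exceeds the 2 in
    \<open>\<phi> \<le> 2 * sin \<phi>\<close>, so that \<open>M * sin \<phi>\<close> is a bound up
    to \<open>pi / 2\<close>.\<close>
  define M where "M = 6 * (C * \<bar>m\<bar>)"
  have "M \<ge> 0"
    using C(1) by (simp add: M_def)
  have bound: "\<bar>m * mode k \<phi>\<bar> \<le> C * \<bar>m\<bar> * \<phi>" if "0 \<le> \<phi>" "\<phi> \<le> 3 * pi / 2" for \<phi>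
    using mult_left_mono[OF C(2)[OF that], of "\<bar>m\<bar>"] by (simp add: abs_mult mult_ac)
  have bound_M: "\<bar>m * mode k \<phi>\<bar> \<le> M" if "0 \<le> \<phi>" "\<phi> \<le> 3 * pi / 2" for \<phi>
  proof -
    have "C * \<bar>m\<bar> * \<phi> \<le> C * \<bar>m\<bar> * 6"
      using that pi_less_4 C(1) by (intro mult_left_mono) auto
    thus ?thesis
      using bound[OF that] by (simp add: M_def)
  qed
  \<comment> \<open>The three entries give \<open>y0 > 0\<close>, the sign of \<open>f\<close> away
    from the return, and \<open>\<bar>\<theta>\<bar> < \<delta>\<close>.\<close>
  define Y where "Y = max 1 (max M (2 * M / \<delta>))"
  have main: "y0 \<in> return_domain ?T ?D ?a \<and>
      \<bar>return_map ?T ?D ?a y0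
         - (- E * y0 + 2 * k * (1 + E) * m - (1 + k\<^sup>2) * (E - 1 / E) / 2 * m\<^sup>2 / y0
            + k * (1 + k\<^sup>2) * (1 + E)\<^sup>2 * (2 - E) / (3 * E\<^sup>2) * m ^ 3 / y0\<^sup>2)\<bar> \<le> 16 * K * M ^ 4 / y0 ^ 3"
    if "y0 > Y" for y0
  proof -
    have y0: "y0 > 0" "y0 > M" "2 * M / y0 < \<delta>"
      using that \<open>\<delta> > 0\<close> by (auto simp: Y_def field_simps)
    define f where "f = (\<lambda>\<phi>. m * mode k \<phi> - y0 * sin \<phi>)"
    have neg: "f \<phi> < 0" if "0 < \<phi>" "\<phi> \<le> pi / 2" for \<phi>
    proof -
      have sin: "0 < sin \<phi>" "\<phi> \<le> 2 * sin \<phi>"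
        using abs_le_2_abs_sin[of \<phi>] sin_gt_zero[of \<phi>] that by auto
      have "m * mode k \<phi> \<le> C * \<bar>m\<bar> * \<phi>"
        using bound[of \<phi>] that by auto
      also have "\<dots> \<le> C * \<bar>m\<bar> * (6 * sin \<phi>)"
        using sin C(1) by (intro mult_left_mono) auto
      also have "\<dots> = M * sin \<phi>"
        by (simp add: M_def)
      also have "\<dots> < y0 * sin \<phi>"
        using y0 sin by (intro mult_strict_right_mono) auto
      finally show ?thesis
        by (simp add: f_def)
    qed
    \<comment> \<open>At \<open>3 * pi / 2\<close> the sine term contributes \<open>+ y0\<close>,
      which dominates \<open>M\<close>. So \<open>f\<close> changes sign between
      \<open>pi / 2\<close> and \<open>3 * pi / 2\<close>, and its first zero there is the return
      phase.\<close>
    have "sin (3 * pi / 2) = - 1"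
      using sin_3over2_pi by (simp add: mult.commute)
    hence "0 < f (3 * pi / 2)"
      using bound_M[of "3 * pi / 2"] y0 by (auto simp: f_def)
    moreover have "continuous_on {pi / 2..3 * pi / 2} f"
      unfolding f_def mode_def by (intro continuous_intros)
    ultimately obtain \<phi> where \<phi>: "pi / 2 < \<phi>" "\<phi> < 3 * pi / 2" "f \<phi> = 0"
      "\<And>s. \<lbrakk>pi / 2 \<le> s; s < \<phi>\<rbrakk> \<Longrightarrow> f s < 0"
      using first_zero[of "pi / 2" "3 * pi / 2" f] neg[of "pi / 2"] by auto
    have "\<phi> > 0"
      using \<phi>(1) pi_gt_zero by linarith
    have flight: "is_flight_time ?T ?D ?a y0 (\<phi> / w)"
    proof (rule is_flight_timeI[OF \<open>w > 0\<close> \<open>\<phi> > 0\<close>])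
      show "m * mode k \<phi> = y0 * sin \<phi>"
        using \<phi>(3) by (simp add: f_def)
      show "m * mode k s < y0 * sin s" if "0 < s" "s < \<phi>" for s
        using neg[of s] \<phi>(4)[of s] that by (cases "s \<le> pi / 2") (auto simp: f_def)
    qed
    define \<theta> where "\<theta> = \<phi> - pi"
    define u where "u = m / y0"
    have \<phi>_eq: "\<phi> = \<theta> + pi"
      by (simp add: \<theta>_def)
    have exp_shift: "exp (- k * (\<theta> + pi)) = exp (- k * \<theta>) / E"
      unfolding E_def exp_diff[symmetric] by (simp add: algebra_simps)
    have mode: "mode k \<phi> = exp (- k * \<theta>) / E + cos \<theta> - k * sin \<theta>"
      "mode' k \<phi> = - k * exp (- k * \<theta>) / E - sin \<theta> - k * cos \<theta>"
      unfolding \<phi>_eq mode_def mode'_def exp_shift by (simp_all only: sin_periodic_pi cos_periodic_pi) simp_all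
    have zero: "m * mode k \<phi> = - y0 * sin \<theta>"
      using \<phi>(3) by (simp add: f_def \<phi>_eq)
    hence u: "u * mode k \<phi> = - sin \<theta>"
      using y0 by (simp add: u_def field_simps)
    \<comment> \<open>The phase equation bounds \<open>y0 * \<bar>sin \<theta>\<bar>\<close> by
      \<open>M\<close>. Because \<open>\<theta>\<close> lies within \<open>pi / 2\<close> of 0, this
      becomes a bound on \<open>\<theta>\<close> itself.\<close>
    have "\<bar>\<theta>\<bar> \<le> 2 * \<bar>sin \<theta>\<bar>"
      using \<phi> by (intro abs_le_2_abs_sin) (auto simp: \<theta>_def abs_if)
    also have "y0 * \<bar>sin \<theta>\<bar> \<le> M"
      using bound_M[of \<phi>] \<phi> \<open>\<phi> > 0\<close> y0 unfolding zero by (simp add: abs_mult)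
    hence "2 * \<bar>sin \<theta>\<bar> \<le> 2 * M / y0"
      using y0 by (simp add: field_simps)
    finally have \<theta>: "\<bar>\<theta>\<bar> \<le> 2 * M / y0" .
    have "return_map ?T ?D ?a y0 = snd (flow k w m y0 (\<phi> / w))"
      using return_map_eq(2)[OF flight] y0 \<open>w > 0\<close> by (simp add: Phi_eq_flow)
    \<comment> \<open>The term with factor \<open>k\<close> in the flow drops out since
      \<open>f \<phi> = 0\<close>, and \<open>cos \<phi> = - cos \<theta>\<close>.\<close>
    also have "\<dots> = - exp (k * \<phi>) * (m * mode' k \<phi> + y0 * cos \<theta>)"
      using \<phi>(3) \<open>w > 0\<close> by (simp add: flow_def f_def) (simp add: \<phi>_eq algebra_simps)
    also have "exp (k * \<phi>) = E * exp (k * \<theta>)"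
      by (simp add: \<phi>_eq E_def ring_distribs exp_add)
    also have "- (E * exp (k * \<theta>)) * (m * mode' k \<phi> + y0 * cos \<theta>) =
        y0 * (- E * exp (k * \<theta>) * (u * mode' k \<phi> + cos \<theta>))"
      using y0 by (simp add: u_def field_simps)
    finally have ret: "return_map ?T ?D ?a y0 = y0 * (- E * exp (k * \<theta>) * (u * mode' k \<phi> + cos \<theta>))" .
    have poly: "- E * y0 + b * m - c * m\<^sup>2 / y0 + d * m ^ 3 / y0\<^sup>2 = y0 * (- E + b * u - c * u\<^sup>2 + d * u ^ 3)"
      for b c d
      using y0 by (simp add: u_def field_simps power2_eq_square power3_eq_cube)
    let ?A = "- E * exp (k * \<theta>) * (u * mode' k \<phi> + cos \<theta>)"
    let ?B = "- E + 2 * k * (1 + E) * u - (1 + k\<^sup>2) * (E - 1 / E) / 2 * u\<^sup>2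
            + k * (1 + k\<^sup>2) * (1 + E)\<^sup>2 * (2 - E) / (3 * E\<^sup>2) * u ^ 3"
    have "\<bar>?A - ?B\<bar> \<le> K * \<theta> ^ 4"
    proof -
      have "\<bar>\<theta>\<bar> < \<delta>"
        using \<theta> y0(3) by (rule le_less_trans)
      thus ?thesis
        using expansion u unfolding mode by blast
    qed
    also have "K * \<theta> ^ 4 \<le> K * (2 * M / y0) ^ 4"
      using power_mono[OF \<theta>, of 4] \<open>K > 0\<close> by (intro mult_left_mono) auto
    finally have "y0 * \<bar>?A - ?B\<bar> \<le> y0 * (K * (2 * M / y0) ^ 4)"
      using y0(1) by (intro mult_left_mono) simp_all
    also have "y0 * (K * (2 * M / y0) ^ 4) = 16 * K * M ^ 4 / y0 ^ 3"
      using y0(1) by (simp add: power_divide power_mult_distrib) (simp add: eval_nat_numeral)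
    finally have "\<bar>y0 * (?A - ?B)\<bar> \<le> 16 * K * M ^ 4 / y0 ^ 3"
      unfolding abs_mult abs_of_pos[OF y0(1)] .
    with return_map_eq(1)[OF flight] y0(1) show ?thesis
      unfolding ret poly right_diff_distrib by (intro conjI) simp_all
  qed
  have "Y > 0"
    by (simp add: Y_def)
  show ?thesis
    by (rule exI, rule conjI, rule \<open>Y > 0\<close>, rule exI, rule allI, rule impI, rule main)
qed

section \<open>Return to the parameters \<open>T\<close>, \<open>D\<close>, \<open>a\<close>\<close>

theorem proposition4:
  fixes T D a :: real
  assumes "a\<^sup>2 + D\<^sup>2 \<noteq> 0"
    and "4 * D - T\<^sup>2 > 0"
  shows "(\<forall>\<^sub>F y0 in at_top. y0 \<in> left_domain T D a) \<and>
    (\<lambda>y0. left_half_map T D a y0 -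
       (- exp (pi * T / sqrt (4 * D - T\<^sup>2)) * y0
        + a * T / D * (1 + exp (pi * T / sqrt (4 * D - T\<^sup>2)))
        - a\<^sup>2 / D * sinh (pi * T / sqrt (4 * D - T\<^sup>2)) * (1 / y0)
        - a ^ 3 * T * exp (- 2 * pi * T / sqrt (4 * D - T\<^sup>2))
            * (- 2 + exp (pi * T / sqrt (4 * D - T\<^sup>2)))
            * (1 + exp (pi * T / sqrt (4 * D - T\<^sup>2)))\<^sup>2 / (6 * D\<^sup>2) * (1 / y0\<^sup>2)))
      \<in> O[at_top](\<lambda>y0. 1 / y0 ^ 3)"
proof -
  \<comment> \<open>\<open>w\<close> and \<open>k * w\<close> are the imaginary and real parts of
    the eigenvalues, and \<open>a / D\<close> is the abscissa of the equilibrium.\<close>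
  define w where "w = sqrt (4 * D - T\<^sup>2) / 2"
  define k where "k = T / (2 * w)"
  define m where "m = w * a / D"
  define E where "E = exp (k * pi)"
  have "w > 0"
    using assms(2) by (simp add: w_def)
  have "D > 0"
    using assms(2) zero_le_power2[of T] by linarith
  have T: "T = 2 * k * w"
    using \<open>w > 0\<close> by (simp add: k_def)
  have "4 * w\<^sup>2 = 4 * D - T\<^sup>2"
    using assms(2) by (simp add: w_def power_divide)
  hence D: "D = w\<^sup>2 * (1 + k\<^sup>2)"
    by (simp add: T algebra_simps)
  have "m * D = w * a"
    using \<open>D > 0\<close> by (simp add: m_def)
  hence "w * (m * w * (1 + k\<^sup>2)) = w * a"
    unfolding D by (simp add: power2_eq_square mult_ac)
  hence a: "a = m * w * (1 + k\<^sup>2)"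
    using \<open>w > 0\<close> unfolding mult_cancel_left by simp
  have kpi: "pi * T / sqrt (4 * D - T\<^sup>2) = k * pi"
    by (simp add: k_def w_def)
  have exp_2: "exp (- 2 * pi * T / sqrt (4 * D - T\<^sup>2)) = 1 / E\<^sup>2"
  proof -
    have "- 2 * pi * T / sqrt (4 * D - T\<^sup>2) = - (k * pi + k * pi)"
      unfolding kpi[symmetric] by simp
    thus ?thesis
      unfolding E_def power2_eq_square by (simp only: exp_minus exp_add inverse_eq_divide)
  qed
  have k1: "1 + k\<^sup>2 > 0"
    by (rule add_pos_nonneg) auto
  \<comment> \<open>In these combinations \<open>w\<close> cancels, leaving only \<open>k\<close>
    and \<open>m\<close>, the quantities in which the return map was expanded.\<close>
  have coeffs: "a * T / D = 2 * k * m" "a\<^sup>2 / D = (1 + k\<^sup>2) * m\<^sup>2"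
    "a ^ 3 * T / (6 * D\<^sup>2) = k * (1 + k\<^sup>2) * m ^ 3 / 3"
    unfolding a T D using \<open>w > 0\<close> k1 by (simp_all add: power2_eq_square power3_eq_cube divide_simps)
  have expansion: "- exp (pi * T / sqrt (4 * D - T\<^sup>2)) * y0
        + a * T / D * (1 + exp (pi * T / sqrt (4 * D - T\<^sup>2)))
        - a\<^sup>2 / D * sinh (pi * T / sqrt (4 * D - T\<^sup>2)) * (1 / y0)
        - a ^ 3 * T * exp (- 2 * pi * T / sqrt (4 * D - T\<^sup>2))
            * (- 2 + exp (pi * T / sqrt (4 * D - T\<^sup>2)))
            * (1 + exp (pi * T / sqrt (4 * D - T\<^sup>2)))\<^sup>2 / (6 * D\<^sup>2) * (1 / y0\<^sup>2) =
      - E * y0 + 2 * k * (1 + E) * m - (1 + k\<^sup>2) * (E - 1 / E) / 2 * m\<^sup>2 / y0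
        + k * (1 + k\<^sup>2) * (1 + E)\<^sup>2 * (2 - E) / (3 * E\<^sup>2) * m ^ 3 / y0\<^sup>2" for y0
  proof -
    have "a ^ 3 * T * (1 / E\<^sup>2) * (- 2 + E) * (1 + E)\<^sup>2 / (6 * D\<^sup>2) * (1 / y0\<^sup>2) =
        a ^ 3 * T / (6 * D\<^sup>2) * ((1 / E\<^sup>2) * (- 2 + E) * (1 + E)\<^sup>2 * (1 / y0\<^sup>2))"
      by (simp add: mult_ac)
    also have "\<dots> = - (k * (1 + k\<^sup>2) * (1 + E)\<^sup>2 * (2 - E) / (3 * E\<^sup>2) * m ^ 3 / y0\<^sup>2)"
      unfolding coeffs by (simp add: divide_simps) (simp add: algebra_simps)
    finally have d: "a ^ 3 * T * (1 / E\<^sup>2) * (- 2 + E) * (1 + E)\<^sup>2 / (6 * D\<^sup>2) * (1 / y0\<^sup>2) =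
      - (k * (1 + k\<^sup>2) * (1 + E)\<^sup>2 * (2 - E) / (3 * E\<^sup>2) * m ^ 3 / y0\<^sup>2)" .
    have sinh: "sinh (k * pi) = (E - 1 / E) / 2"
      by (simp add: sinh_def E_def exp_minus inverse_eq_divide)
    show ?thesis
      unfolding exp_2 kpi E_def[symmetric] d sinh coeffs(1,2) by simp
  qed
  obtain Y K where Y: "Y > 0"
    and expansion_bound: "\<forall>y0>Y. y0 \<in> return_domain T D a \<and> \<bar>return_map T D a y0
         - (- E * y0 + 2 * k * (1 + E) * m - (1 + k\<^sup>2) * (E - 1 / E) / 2 * m\<^sup>2 / y0
            + k * (1 + k\<^sup>2) * (1 + E)\<^sup>2 * (2 - E) / (3 * E\<^sup>2) * m ^ 3 / y0\<^sup>2)\<bar> \<le> K / y0 ^ 3"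
    using return_map_expansion[OF \<open>w > 0\<close>, of k m, folded T D a E_def] by (elim exE conjE)
  \<comment> \<open>Every \<open>y0 > Y\<close> lies in \<open>return_domain\<close>, so the first
    branch of \<open>left_half_map\<close> applies and both claims reduce to
    \<open>return_map\<close>.\<close>
  note dom = expansion_bound[rule_format, THEN conjunct1]
    and bound = expansion_bound[rule_format, THEN conjunct2]
  have "\<forall>\<^sub>F y0 in at_top. y0 \<in> left_domain T D a"
    using eventually_gt_at_top[of Y] by eventually_elim (simp add: left_domain_def dom)
  moreover have "(\<lambda>y0. left_half_map T D a y0
      - (- E * y0 + 2 * k * (1 + E) * m - (1 + k\<^sup>2) * (E - 1 / E) / 2 * m\<^sup>2 / y0
         + k * (1 + k\<^sup>2) * (1 + E)\<^sup>2 * (2 - E) / (3 * E\<^sup>2) * m ^ 3 / y0\<^sup>2)) \<in> O[at_top](\<lambda>y0. 1 / y0 ^ 3)"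
  proof (rule bigoI[where c = K])
    show "\<forall>\<^sub>F y0 in at_top. norm (left_half_map T D a y0
      - (- E * y0 + 2 * k * (1 + E) * m - (1 + k\<^sup>2) * (E - 1 / E) / 2 * m\<^sup>2 / y0
         + k * (1 + k\<^sup>2) * (1 + E)\<^sup>2 * (2 - E) / (3 * E\<^sup>2) * m ^ 3 / y0\<^sup>2)) \<le> K * norm (1 / y0 ^ 3)"
      using eventually_gt_at_top[of Y]
    proof eventually_elim
      case (elim y0)
      thus ?case
        using bound[OF elim] Y by (simp add: left_half_map_def dom)
    qed
  qed
  ultimately show ?thesis
    unfolding expansion by blast
qed

end
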